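(* Let $G$ be any connected graph and let $U\subseteq V(G)$ be any vertex set. Then exactly one of the following two assertions holds: (i) $G$ contains a comb attached to $U$; (ii) there is a rayless normal tree $T\subseteq G$ that contains $U$ (that is, $U\subseteq V(T)$). Moreover, the normal tree $T$ in (ii) can be chosen such that it contains $U$ cofinally.
   Context: Graphs may be infinite. A ray is a one-way infinite path. A comb is the union of a ray $R$ (its spine) with infinitely many disjoint finite paths, possibly trivial, that have precisely their first vertex on $R$; the last vertices of these paths are the teeth of the comb. A comb attached to $U$ is a comb all of whose teeth lie in $U$. A rooted tree $T$ with root $r$ carries the tree-order: $x\le y$ if $x$ lies on the path $rTy$. A rooted tree $T\subseteq G$ (a subgraph, not necessarily spanning) is normal in $G$ if the endvertices of every $T$-path in $G$ are comparable in the tree-order of $T$, where a $T$-path is a non-trivial path in $G$ whose endvertices but no inner vertices lie in $T$. A tree is rayless if it contains no ray. A rooted tree $T\subseteq G$ contains a vertex set $W$ cofinally if $W\subseteq V(T)$ and for every $t\in V(T)$ there is $w\in W$ with $w\ge t$ in the tree-order of $T$.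
   Formalization: The "moreover" clause is stated only for non-empty U: for U empty, (ii) holds, but no rooted tree contains U cofinally, since its root has no vertex of U above it. The dichotomy itself is stated for every U. *)

theory Defs
  imports "Graph_Theory.Graph_Theory"
begin

text \<open>
  An undirected simple graph, finite or infinite, is a loopfree symmetric pair digraph
  (\<^locale>\<open>pair_bidirected_digraph\<close>): every edge \<open>uv\<close> is represented by the two arcs
  \<open>(u, v)\<close> and \<open>(v, u)\<close>. Under this encoding \<^const>\<open>subgraph\<close>, \<^const>\<open>connected\<close> (which includes
  non-emptiness) and \<^const>\<open>vpath\<close> (a path, given by its non-empty list of vertices, possibly of
  length one) have their usual undirected meaning.
\<close>

text \<open>
  The library's \<^const>\<open>tree\<close> is not suitable here, since it regards the two arcs of a single
  edge as a cycle. We therefore require cycles to have at least three vertices.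
\<close>

definition acyclic_graph :: "'a pair_pre_digraph \<Rightarrow> bool" where
  "acyclic_graph T \<longleftrightarrow> \<not> (\<exists>p. vpath p T \<and> length p \<ge> 3 \<and> (last p, hd p) \<in> parcs T)"

definition rooted_tree :: "'a pair_pre_digraph \<Rightarrow> 'a \<Rightarrow> bool" where
  "rooted_tree T r \<longleftrightarrow>
     pair_bidirected_digraph T \<and> connected T \<and> acyclic_graph T \<and> r \<in> pverts T"

definition tree_le :: "'a pair_pre_digraph \<Rightarrow> 'a \<Rightarrow> 'a \<Rightarrow> 'a \<Rightarrow> bool" where
  "tree_le T r x y \<longleftrightarrow> (\<exists>p. vpath p T \<and> hd p = r \<and> last p = y \<and> x \<in> set p)"

definition path_relative_to :: "'a pair_pre_digraph \<Rightarrow> 'a pair_pre_digraph \<Rightarrow> 'a list \<Rightarrow> bool" where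
  "path_relative_to T G p \<longleftrightarrow>
     vpath p G \<and> length p \<ge> 2 \<and> hd p \<in> pverts T \<and> last p \<in> pverts T \<and>
     set (butlast (tl p)) \<inter> pverts T = {}"

definition normal_tree :: "'a pair_pre_digraph \<Rightarrow> 'a pair_pre_digraph \<Rightarrow> 'a \<Rightarrow> bool" where
  "normal_tree G T r \<longleftrightarrow>
     rooted_tree T r \<and> subgraph T G \<and>
     (\<forall>p. path_relative_to T G p \<longrightarrow>
        tree_le T r (hd p) (last p) \<or> tree_le T r (last p) (hd p))"

definition ray :: "'a pair_pre_digraph \<Rightarrow> (nat \<Rightarrow> 'a) \<Rightarrow> bool" where
  "ray G R \<longleftrightarrow> inj R \<and> (\<forall>i. R i \<in> pverts G \<and> (R i, R (Suc i)) \<in> parcs G)"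

definition rayless :: "'a pair_pre_digraph \<Rightarrow> bool" where
  "rayless G \<longleftrightarrow> \<not> (\<exists>R. ray G R)"

text \<open>
  A comb in \<open>G\<close> is given by its spine \<open>R\<close> and its set \<open>P\<close> of paths, each listed from its
  first vertex (on \<open>R\<close>) to its last vertex (a tooth).
\<close>

definition comb :: "'a pair_pre_digraph \<Rightarrow> (nat \<Rightarrow> 'a) \<Rightarrow> 'a list set \<Rightarrow> bool" where
  "comb G R P \<longleftrightarrow>
     ray G R \<and> infinite P \<and>
     (\<forall>p\<in>P. vpath p G \<and> set p \<inter> range R = {hd p}) \<and>
     pairwise (\<lambda>p q. set p \<inter> set q = {}) P"

definition teeth :: "'a list set \<Rightarrow> 'a set" where
  "teeth P = last ` P"

definition contains_cofinally :: "'a pair_pre_digraph \<Rightarrow> 'a \<Rightarrow> 'a set \<Rightarrow> bool" where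
  "contains_cofinally T r W \<longleftrightarrow> W \<subseteq> pverts T \<and> (\<forall>t\<in>pverts T. \<exists>w\<in>W. tree_le T r t w)"

end

theory Submission
  imports Defs "HOL-Library.Sublist"
begin

text \<open>
  Exclusion: if almost all teeth of a comb lie above a vertex \<open>t\<close> of a normal tree containing all
  teeth, then they almost all lie above a single child of \<open>t\<close>, since deleting the finitely many
  vertices below \<open>t\<close> leaves almost all of the comb connected. Iterating from the root gives a ray.

  Existence: by Zorn's lemma there is a maximal normal tree \<open>T\<close> with a fixed root in \<open>U\<close> that contains
  \<open>U \<inter> V(T)\<close> cofinally. A ray in \<open>T\<close> would, by cofinality, be the spine of a comb attached to \<open>U\<close>,
  so \<open>T\<close> is rayless. If a component \<open>C\<close> of \<open>G - T\<close> met \<open>U\<close>, its neighbourhood in \<open>T\<close> would be a chain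
  with a maximum \<open>t\<close>, and a path from \<open>t\<close> through \<open>C\<close> to \<open>U\<close> could be added to \<open>T\<close>.
\<close>

section \<open>Paths\<close>

lemma bidirected_iff:
  "pair_bidirected_digraph G \<longleftrightarrow>
     (\<forall>u v. (u, v) \<in> parcs G \<longrightarrow> u \<in> pverts G \<and> v \<in> pverts G \<and> (v, u) \<in> parcs G \<and> u \<noteq> v)"
proof
  assume "pair_bidirected_digraph G"
  then interpret pair_bidirected_digraph G .
  show "\<forall>u v. (u, v) \<in> parcs G \<longrightarrow> u \<in> pverts G \<and> v \<in> pverts G \<and> (v, u) \<in> parcs G \<and> u \<noteq> v"
    using arc_fst_in_verts arc_snd_in_verts pair_sym_arcs pair_no_loops
    by (fastforce simp: symmetric_def sym_def)
next
  assume "\<forall>u v. (u, v) \<in> parcs G \<longrightarrow> u \<in> pverts G \<and> v \<in> pverts G \<and> (v, u) \<in> parcs G \<and> u \<noteq> v"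
  then show "pair_bidirected_digraph G"
    by unfold_locales (auto simp: symmetric_def sym_def)
qed

lemma bidirectedD:
  assumes "pair_bidirected_digraph G" "(u, v) \<in> parcs G"
  shows "u \<in> pverts G" "v \<in> pverts G" "(v, u) \<in> parcs G" "u \<noteq> v"
  using assms by (auto simp: bidirected_iff)

lemma list_two_ends:
  assumes "length p \<ge> 2"
  obtains y i z where "p = y # i @ [z]"
proof -
  obtain y q where q: "p = y # q" "q \<noteq> []"
    using assms by (cases p) (auto simp: Suc_le_eq)
  then have "p = y # butlast q @ [last q]" by simp
  then show ?thesis by (rule that)
qed

text \<open>Used for cycles in trees given by their arcs, whose vertices are collected as tails of
  arcs. Every vertex of the list but the last is the tail of the next arc; the last one needs
  symmetry.\<close>

lemma successively_arcs_subset: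
  assumes "successively (\<lambda>x y. (x, y) \<in> A) p" "length p \<ge> 2" "sym A"
  shows "set p \<subseteq> fst ` A"
proof
  fix x assume "x \<in> set p"
  then obtain a b where p: "p = a @ x # b" by (meson split_list)
  show "x \<in> fst ` A"
  proof (cases b)
    case (Cons y b')
    then have "(x, y) \<in> A" using assms(1) p by (simp add: successively_append_iff)
    then show ?thesis by force
  next
    case Nil
    then have "a \<noteq> []" using assms(2) p by auto
    then have "(last a, x) \<in> A" using assms(1) p Nil by (simp add: successively_append_iff)
    then have "(x, last a) \<in> A" using assms(3) by (simp add: sym_def)
    then show ?thesis by force
  qed
qed

section \<open>Elementary forms of subgraphs, paths and their concatenation\<close>

lemma subgraph_iff:
  assumes "pair_bidirected_digraph H" "pair_bidirected_digraph G"
  shows "subgraph H G \<longleftrightarrow> pverts H \<subseteq> pverts G \<and> parcs H \<subseteq> parcs G"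
proof -
  interpret H: pair_bidirected_digraph H by fact
  interpret G: pair_bidirected_digraph G by fact
  show ?thesis
    by (auto simp: subgraph_def compatible_def wf_digraph_wp_iff H.pair_wf_digraph_axioms
        G.pair_wf_digraph_axioms)
qed

lemma vwalk_arcs_subset_iff:
  "set (vwalk_arcs p) \<subseteq> A \<longleftrightarrow> successively (\<lambda>x y. (x, y) \<in> A) p"
  by (induction p rule: vwalk_arcs.induct) auto

lemma vpath_iff:
  "vpath p (with_proj G) \<longleftrightarrow>
     p \<noteq> [] \<and> distinct p \<and> set p \<subseteq> pverts G \<and> successively (\<lambda>x y. (x, y) \<in> parcs G) p"
  by (auto simp: vpath_def vwalk_def vwalk_arcs_subset_iff)

lemma vpath_mono:
  assumes "vpath p (with_proj H)" "pverts H \<subseteq> pverts G" "parcs H \<subseteq> parcs G"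
  shows "vpath p (with_proj G)"
  using assms by (auto simp: vpath_iff elim!: successively_mono)

lemma vpath_appendD:
  assumes "vpath (p @ q) (with_proj G)"
  shows "p \<noteq> [] \<Longrightarrow> vpath p (with_proj G)" "q \<noteq> [] \<Longrightarrow> vpath q (with_proj G)"
  using assms by (auto simp: vpath_iff successively_append_iff)

lemma vpath_join:
  assumes "vpath (p @ [z]) (with_proj G)" "vpath (z # q) (with_proj G)" "set p \<inter> set q = {}"
  shows "vpath (p @ z # q) (with_proj G)"
  using assms by (auto simp: vpath_iff successively_append_iff)

lemma vpath_rev:
  assumes "pair_bidirected_digraph G" "vpath p (with_proj G)"
  shows "vpath (rev p) (with_proj G)"
  using assms(2) bidirectedD(3)[OF assms(1)] by (auto simp: vpath_iff elim!: successively_mono)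

lemma vpath_snoc:
  assumes "pair_bidirected_digraph G" "vpath p (with_proj G)" "(last p, x) \<in> parcs G" "x \<notin> set p"
  shows "vpath (p @ [x]) (with_proj G)"
  using assms(2-) bidirectedD(2)[OF assms(1)] by (auto simp: vpath_iff successively_append_iff)

text \<open>The reflexive transitive closure of this relation is reachability in
  \<open>G - X\<close>. It also relates every element to itself, even one in \<open>X\<close> or
  outside \<open>G\<close>, so lemmas that extract paths require the start to be a vertex outside
  \<open>X\<close>.\<close>

definition arcs_off :: "'a pair_pre_digraph \<Rightarrow> 'a set \<Rightarrow> 'a rel" where
  "arcs_off G X = {(a, b) \<in> parcs G. a \<notin> X \<and> b \<notin> X}"

lemma arcs_off_sym:
  assumes "pair_bidirected_digraph G" "(a, b) \<in> (arcs_off G X)\<^sup>*"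
  shows "(b, a) \<in> (arcs_off G X)\<^sup>*"
proof -
  have "sym (arcs_off G X)"
    using assms(1) by (auto simp: arcs_off_def sym_def bidirected_iff)
  then show ?thesis using assms(2) by (meson sym_rtrancl symD)
qed

text \<open>A walk is turned into a path as it grows: when its next vertex already lies on the path
  built so far, the path is cut back to that vertex.\<close>

lemma arcs_off_imp_vpath:
  assumes "pair_bidirected_digraph G" "(a, b) \<in> (arcs_off G X)\<^sup>*" "a \<in> pverts G" "a \<notin> X"
  obtains p where "vpath p (with_proj G)" "hd p = a" "last p = b" "set p \<inter> X = {}"
proof -
  from assms(2) have "\<exists>p. vpath p (with_proj G) \<and> hd p = a \<and> last p = b \<and> set p \<inter> X = {}"
  proof induction
    case base
    show ?case using assms by (intro exI[of _ "[a]"]) (auto simp: vpath_iff)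
  next
    case (step b c)
    then obtain p where p: "vpath p (with_proj G)" "hd p = a" "last p = b" "set p \<inter> X = {}"
      by blast
    have bc: "(b, c) \<in> parcs G" "c \<notin> X" using step by (auto simp: arcs_off_def)
    show ?case
    proof (cases "c \<in> set p")
      case True
      then obtain q1 q2 where q: "p = q1 @ c # q2" by (meson split_list)
      have "vpath (q1 @ [c]) (with_proj G)"
        using p q by (intro vpath_appendD(1)[of "q1 @ [c]" q2]) auto
      then show ?thesis using p q
        by (intro exI[of _ "q1 @ [c]"]) (auto simp: hd_append)
    next
      case False
      then have "vpath (p @ [c]) (with_proj G)" using assms p bc by (intro vpath_snoc) auto
      moreover have "hd (p @ [c]) = a" using p by (auto simp: vpath_iff)
      ultimately show ?thesis using p bc by (intro exI[of _ "p @ [c]"]) auto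
    qed
  qed
  then show ?thesis using that by blast
qed

lemma vpath_imp_arcs_off:
  assumes "vpath p (with_proj G)" "set p \<inter> X = {}"
  shows "(hd p, last p) \<in> (arcs_off G X)\<^sup>*"
proof -
  have "p \<noteq> []" "successively (\<lambda>x y. (x, y) \<in> parcs G) p" using assms by (auto simp: vpath_iff)
  then show ?thesis using assms(2)
  proof (induction p rule: list_nonempty_induct)
    case (cons x p)
    then have "(x, hd p) \<in> arcs_off G X"
      by (cases p) (auto simp: arcs_off_def)
    moreover have "(hd p, last p) \<in> (arcs_off G X)\<^sup>*"
      using cons by (cases p) auto
    ultimately show ?case using cons by (simp add: converse_rtrancl_into_rtrancl)
  qed auto
qed

text \<open>The arcs are already symmetric and stay inside the vertex set, so neither the symmetric
  closure nor the restriction to vertices in the library definition changes reachability.\<close>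

lemma connected_iff:
  assumes "pair_bidirected_digraph G"
  shows "connected (with_proj G) \<longleftrightarrow>
     pverts G \<noteq> {} \<and> (\<forall>u\<in>pverts G. \<forall>v\<in>pverts G. (u, v) \<in> (parcs G)\<^sup>*)"
proof -
  have arcs: "parcs (mk_symmetric (with_proj G)) = parcs G"
    using assms by (fastforce simp: parcs_mk_symmetric bidirected_iff)
  have "(u, v) \<in> rtrancl_on (pverts G) (parcs G)"
    if "(u, v) \<in> (parcs G)\<^sup>*" "u \<in> pverts G" for u v
    using that
    by induction (auto intro: rtrancl_on_into_rtrancl_on bidirectedD[OF assms])
  moreover have "(u, v) \<in> (parcs G)\<^sup>*" if "(u, v) \<in> rtrancl_on (pverts G) (parcs G)" for u v
    using that by (induction rule: rtrancl_on.induct) auto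
  ultimately show ?thesis
    by (auto simp: connected_def strongly_connected_def reachable_def arcs)
qed

lemma connected_ex_vpath:
  assumes "pair_bidirected_digraph G" "connected (with_proj G)" "u \<in> pverts G" "v \<in> pverts G"
  obtains p where "vpath p (with_proj G)" "hd p = u" "last p = v"
proof -
  have "(u, v) \<in> (arcs_off G {})\<^sup>*"
    using assms by (auto simp: connected_iff arcs_off_def)
  from arcs_off_imp_vpath[OF assms(1) this assms(3)] that show ?thesis by blast
qed

section \<open>Rooted trees\<close>

text \<open>Common initial vertices are stripped by induction. If the paths diverge after
  \<open>a\<close>, the second is followed until it first meets the first again, at
  \<open>z\<close>; the two segments from \<open>a\<close> to \<open>z\<close> close up to a
  cycle.\<close>

lemma acyclic_vpath_unique:
  assumes "pair_bidirected_digraph T" "acyclic_graph T"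
    and "vpath p (with_proj T)" "vpath q (with_proj T)" "hd p = hd q" "last p = last q"
  shows "p = q"
  using assms(3-)
proof (induction p arbitrary: q)
  case (Cons a p)
  obtain q' where q: "q = a # q'" using Cons.prems by (cases q) (auto simp: vpath_iff)
  have nil: "p = [] \<longleftrightarrow> q' = []"
    using Cons.prems q by (auto simp: vpath_iff split: if_splits dest: last_in_set)
  show ?case
  proof (cases "p = []")
    case True
    then show ?thesis using nil q by simp
  next
    case False
    then obtain b p1 c q1 where bc: "p = b # p1" "q' = c # q1"
      using nil by (meson neq_Nil_conv)
    have vp: "vpath p (with_proj T)" "vpath q' (with_proj T)"
      using Cons.prems q bc by (auto simp: vpath_iff)
    show ?thesis
    proof (cases "b = c")
      case True
      then show ?thesis using Cons.IH[of q'] vp Cons.prems q bc by auto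
    next
      case bnc: False
      have "last q' = last p" "p \<noteq> []" using Cons.prems q bc by simp_all
      then have "last q' \<in> set p" by (metis last_in_set)
      then have "\<exists>x\<in>set q'. x \<in> set p" using bc by (intro bexI[of _ "last q'"]) auto
      then obtain q2 z q3 where z: "q' = q2 @ z # q3" "z \<in> set p" "\<forall>y\<in>set q2. y \<notin> set p"
        by (elim split_list_first_propE) auto
      obtain p2 p3 where p2: "p = p2 @ z # p3" using z(2) by (meson split_list)
      let ?C = "a # p2 @ z # rev q2"
      have "vpath (a # p2 @ [z]) (with_proj T)"
        using Cons.prems(1) vpath_appendD(1)[of "a # p2 @ [z]" p3 T] p2 by simp
      moreover have "vpath (rev (q2 @ [z])) (with_proj T)"
        using vp(2) vpath_appendD(1)[of "q2 @ [z]" q3 T] z(1)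
        by (intro vpath_rev[OF assms(1)]) simp
      moreover have "set (a # p2) \<inter> set (rev q2) = {}"
        using Cons.prems q z p2 by (auto simp: vpath_iff)
      ultimately have "vpath ?C (with_proj T)"
        using vpath_join[of "a # p2" z T "rev q2"] by simp
      \<comment> \<open>If both \<open>p2\<close> and \<open>q2\<close> were empty, \<open>z\<close>
        would be the second vertex of both paths, contradicting \<open>b \<noteq> c\<close>.\<close>
      moreover have "length ?C \<ge> 3"
        using bnc bc z p2 by (cases p2; cases q2) auto
      moreover have "(last ?C, hd ?C) \<in> parcs T"
      proof -
        have "last ?C = c" using z(1) bc by (cases q2) auto
        moreover have "(a, c) \<in> parcs T" using Cons.prems(2) q bc by (simp add: vpath_iff)
        ultimately show ?thesis using bidirectedD(3)[OF assms(1)] by simp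
      qed
      ultimately show ?thesis using assms(2) unfolding acyclic_graph_def by blast
    qed
  qed
qed (auto simp: vpath_iff)

section \<open>Root paths, the tree-order and children\<close>

definition root_path :: "'a pair_pre_digraph \<Rightarrow> 'a \<Rightarrow> 'a \<Rightarrow> 'a list" where
  "root_path T r x = (THE p. vpath p (with_proj T) \<and> hd p = r \<and> last p = x)"

text \<open>The equation between root paths makes the level rise by exactly one, which is what the
  arguments about rays count.\<close>

definition child :: "'a pair_pre_digraph \<Rightarrow> 'a \<Rightarrow> 'a \<Rightarrow> 'a \<Rightarrow> bool" where
  "child T r x y \<longleftrightarrow> (x, y) \<in> parcs T \<and> root_path T r y = root_path T r x @ [y]"

lemma tree_le_mono:
  assumes "tree_le S r x y" "pverts S \<subseteq> pverts T" "parcs S \<subseteq> parcs T"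
  shows "tree_le T r x y"
proof -
  obtain p where p: "vpath p (with_proj S)" "hd p = r" "last p = y" "x \<in> set p"
    using assms(1) by (auto simp: tree_le_def)
  show ?thesis unfolding tree_le_def using vpath_mono[OF p(1) assms(2,3)] p(2-) by blast
qed

context
  fixes T :: "'a pair_pre_digraph" and r :: 'a
  assumes tree: "rooted_tree T r"
begin

lemma rooted_tree_bidirected: "pair_bidirected_digraph T"
  using tree by (simp add: rooted_tree_def)

lemma rooted_tree_root: "r \<in> pverts T"
  using tree by (simp add: rooted_tree_def)

lemma root_path_eqI:
  assumes "vpath p (with_proj T)" "hd p = r" "last p = x"
  shows "root_path T r x = p"
  unfolding root_path_def
proof (rule the_equality)
  show "q = p" if "vpath q (with_proj T) \<and> hd q = r \<and> last q = x" for q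
    using that assms tree by (intro acyclic_vpath_unique[of T q p]) (simp_all add: rooted_tree_def)
qed (use assms in simp)

lemma root_path:
  assumes "x \<in> pverts T"
  shows "vpath (root_path T r x) (with_proj T)" "hd (root_path T r x) = r"
    "last (root_path T r x) = x"
proof -
  obtain p where p: "vpath p (with_proj T)" "hd p = r" "last p = x"
    using connected_ex_vpath[of T r x] tree assms by (auto simp: rooted_tree_def)
  then show "vpath (root_path T r x) (with_proj T)" "hd (root_path T r x) = r"
    "last (root_path T r x) = x"
    using root_path_eqI[OF p] by simp_all
qed

lemma root_path_nonempty: "x \<in> pverts T \<Longrightarrow> root_path T r x \<noteq> []"
  using root_path(1)[of x] by (simp add: vpath_iff)

lemma root_path_subset: "x \<in> pverts T \<Longrightarrow> set (root_path T r x) \<subseteq> pverts T"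
  using root_path(1)[of x] by (simp add: vpath_iff)

lemma root_path_split:
  assumes "y \<in> pverts T" "root_path T r y = p @ x # q"
  shows "root_path T r x = p @ [x]"
proof (rule root_path_eqI)
  show "vpath (p @ [x]) (with_proj T)"
    using root_path(1)[OF assms(1)] assms(2) vpath_appendD(1)[of "p @ [x]" q] by simp
  show "hd (p @ [x]) = r" using root_path(2)[OF assms(1)] assms(2) by (auto simp: hd_append)
qed simp

lemma tree_le_iff: "tree_le T r x y \<longleftrightarrow> y \<in> pverts T \<and> x \<in> set (root_path T r y)"
proof
  assume "tree_le T r x y"
  then obtain p where "vpath p (with_proj T)" "hd p = r" "last p = y" "x \<in> set p"
    by (auto simp: tree_le_def)
  then show "y \<in> pverts T \<and> x \<in> set (root_path T r y)"
    using root_path_eqI[of p y] last_in_set[of p] unfolding vpath_iff by (metis subsetD)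
next
  assume "y \<in> pverts T \<and> x \<in> set (root_path T r y)"
  then show "tree_le T r x y" using root_path[of y] by (auto simp: tree_le_def)
qed

lemma tree_le_verts: "tree_le T r x y \<Longrightarrow> x \<in> pverts T \<and> y \<in> pverts T"
  using root_path_subset[of y] by (auto simp: tree_le_iff)

text \<open>Initial segments of root paths are root paths. The tree-order thus becomes the prefix
  order on lists, from which the order laws and the comparability of any two vertices below a third
  are inherited.\<close>

lemma tree_le_prefix:
  assumes "x \<in> pverts T" "y \<in> pverts T"
  shows "tree_le T r x y \<longleftrightarrow> prefix (root_path T r x) (root_path T r y)"
proof
  assume "tree_le T r x y"
  then have "x \<in> set (root_path T r y)" by (simp add: tree_le_iff)
  then obtain p q where pq: "root_path T r y = p @ x # q" by (meson split_list)
  then show "prefix (root_path T r x) (root_path T r y)"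
    using root_path_split[OF assms(2) pq] by simp
next
  assume "prefix (root_path T r x) (root_path T r y)"
  moreover have "x \<in> set (root_path T r x)"
    using last_in_set[OF root_path_nonempty[OF assms(1)]] root_path(3)[OF assms(1)] by simp
  ultimately show "tree_le T r x y"
    using set_mono_prefix assms(2) by (auto simp: tree_le_iff)
qed

lemma tree_le_refl: "x \<in> pverts T \<Longrightarrow> tree_le T r x x"
  by (simp add: tree_le_prefix)

lemma tree_le_trans: "tree_le T r x y \<Longrightarrow> tree_le T r y z \<Longrightarrow> tree_le T r x z"
  by (meson prefix_order.trans tree_le_prefix tree_le_verts)

lemma tree_le_antisym: "tree_le T r x y \<Longrightarrow> tree_le T r y x \<Longrightarrow> x = y"
  by (metis prefix_order.antisym root_path(3) tree_le_prefix tree_le_verts)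

lemma tree_le_linear:
  assumes "tree_le T r x z" "tree_le T r y z"
  shows "tree_le T r x y \<or> tree_le T r y x"
  using tree_le_verts[OF assms(1)] tree_le_verts[OF assms(2)] assms prefix_same_cases
  by (auto simp: tree_le_prefix)

lemma root_le: "x \<in> pverts T \<Longrightarrow> tree_le T r r x"
  using root_path(2)[of x] hd_in_set[OF root_path_nonempty[of x]] by (simp add: tree_le_iff)

text \<open>If \<open>y\<close> is not on the root path of \<open>x\<close>, appending it gives the
  root path of \<open>y\<close>. Otherwise the root path of \<open>y\<close> is an initial segment
  that misses \<open>x\<close>, and \<open>x\<close> can be appended to it.\<close>

lemma arc_child:
  assumes "(x, y) \<in> parcs T"
  shows "child T r x y \<or> child T r y x"
proof -
  note bd = rooted_tree_bidirected
  have xy: "x \<in> pverts T" "y \<in> pverts T" "x \<noteq> y" "(y, x) \<in> parcs T"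
    using bidirectedD[OF bd assms] by auto
  show ?thesis
  proof (cases "y \<in> set (root_path T r x)")
    case False
    have "root_path T r y = root_path T r x @ [y]"
      using False xy root_path[OF xy(1)] root_path_nonempty[OF xy(1)] assms
      by (intro root_path_eqI vpath_snoc[OF bd]) auto
    then show ?thesis using assms by (simp add: child_def)
  next
    case True
    then obtain p q where pq: "root_path T r x = p @ y # q" by (meson split_list)
    then have y: "root_path T r y = p @ [y]" using root_path_split xy by blast
    have "x \<notin> set (p @ [y])"
      using root_path[OF xy(1)] xy(3) pq by (auto simp: vpath_iff split: if_splits)
    then have "root_path T r x = root_path T r y @ [x]"
      using xy root_path[OF xy(2)] root_path_nonempty[OF xy(2)] unfolding y[symmetric]
      by (intro root_path_eqI vpath_snoc[OF bd]) auto
    then show ?thesis using xy by (simp add: child_def)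
  qed
qed

lemma child_less:
  assumes "child T r x y"
  shows "tree_le T r x y" "x \<noteq> y" "x \<in> pverts T" "y \<in> pverts T"
proof -
  show xy: "x \<noteq> y" "x \<in> pverts T" "y \<in> pverts T"
    using assms bidirectedD[OF rooted_tree_bidirected] by (auto simp: child_def)
  show "tree_le T r x y" using assms xy by (simp add: tree_le_prefix child_def)
qed

lemma child_below:
  assumes "tree_le T r x y" "x \<noteq> y"
  obtains c where "child T r x c" "tree_le T r c y"
proof -
  have y: "y \<in> pverts T" using assms(1) tree_le_verts by blast
  have "x \<in> set (root_path T r y)" using assms(1) by (simp add: tree_le_iff)
  then obtain p q where pq: "root_path T r y = p @ x # q" by (meson split_list)
  moreover have "q \<noteq> []" using pq root_path(3)[OF y] assms(2) by auto
  ultimately obtain c q' where c: "root_path T r y = p @ x # c # q'" by (metis neq_Nil_conv)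
  have "root_path T r c = (p @ [x]) @ [c]"
    using root_path_split[of y "p @ [x]" c q'] c y by simp
  moreover have "root_path T r x = p @ [x]" using root_path_split[OF y pq] .
  moreover have "(x, c) \<in> parcs T"
    using root_path(1)[OF y] c by (auto simp: vpath_iff successively_append_iff)
  moreover have "tree_le T r c y" using c y by (simp add: tree_le_iff)
  ultimately show ?thesis using that by (simp add: child_def)
qed

lemma child_le_cases:
  assumes "child T r x c" "tree_le T r y c"
  shows "y = c \<or> y \<in> set (root_path T r x)"
  using assms by (auto simp: tree_le_iff child_def)

text \<open>Levels strictly increase along the sequence, so no vertex repeats.\<close>

lemma children_ray:
  assumes "\<And>i. child T r (R i) (R (Suc i))"
  shows "ray T R"
proof -
  have len: "length (root_path T r (R i)) = length (root_path T r (R 0)) + i" for i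
    using assms by (induction i) (auto simp: child_def)
  have "inj R" by (rule injI) (metis len add_left_cancel)
  moreover have "R i \<in> pverts T" "(R i, R (Suc i)) \<in> parcs T" for i
    using assms[of i] child_less(3) by (auto simp: child_def)
  ultimately show ?thesis by (simp add: ray_def)
qed

text \<open>The form in which raylessness is used: if every vertex of \<open>S\<close> had a child
  in \<open>S\<close>, dependent choice would produce a ray.\<close>

lemma rayless_ex_no_child:
  assumes "rayless T" "S \<noteq> {}"
  shows "\<exists>m\<in>S. \<forall>c. child T r m c \<longrightarrow> c \<notin> S"
proof (rule ccontr)
  assume "\<not> ?thesis"
  then have step: "\<exists>c. c \<in> S \<and> child T r x c" if "x \<in> S" for x using that by blast
  obtain x where "x \<in> S" using assms(2) by blast
  then obtain R where "\<forall>i::nat. R i \<in> S \<and> child T r (R i) (R (Suc i))"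
    using dependent_nat_choice[of "\<lambda>_ x. x \<in> S" "\<lambda>_ x y. child T r x y"] step by blast
  then show False using children_ray[of R] assms(1) by (auto simp: rayless_def)
qed

lemma rayless_ex_maximal:
  assumes "rayless T" "S \<noteq> {}" "S \<subseteq> pverts T"
  shows "\<exists>m\<in>S. \<forall>x\<in>S. tree_le T r m x \<longrightarrow> x = m"
proof -
  \<comment> \<open>Between two comparable vertices of \<open>S\<close> there may be vertices
    outside \<open>S\<close>, so children are sought in the down-closure. A vertex of
    \<open>D\<close> without a child in \<open>D\<close> must itself be in \<open>S\<close>.\<close>
  define D where "D = {t. \<exists>s\<in>S. tree_le T r t s}"
  have "D \<noteq> {}" using assms tree_le_refl unfolding D_def by blast
  from rayless_ex_no_child[OF assms(1) this]
  obtain m where m: "m \<in> D" and no: "\<forall>c. child T r m c \<longrightarrow> c \<notin> D"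
    by blast
  have eq: "x = m" if x: "x \<in> S" "tree_le T r m x" for x
  proof (rule ccontr)
    assume "x \<noteq> m"
    then obtain c where "child T r m c" "tree_le T r c x" using child_below[OF x(2)] by metis
    then show False using no x(1) unfolding D_def by blast
  qed
  then have "m \<in> S" using m unfolding D_def by blast
  then show ?thesis using eq by blast
qed

end

section \<open>Combs and rayless normal trees exclude each other\<close>

text \<open>The path is cut at its visits to \<open>T\<close>. Each piece is a
  \<open>T\<close>-path, so its ends are comparable by normality, and leaving the part above
  \<open>s\<close> would mean passing through a vertex of the root path of \<open>t\<close>.\<close>

lemma normal_tree_child_closed:
  assumes "normal_tree G T r" "child T r t s"
    and "vpath q (with_proj G)" "hd q \<in> pverts T" "last q \<in> pverts T"
    and "tree_le T r s (hd q)" "set q \<inter> set (root_path T r t) = {}"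
  shows "tree_le T r s (last q)"
  using assms(3-)
proof (induction "length q" arbitrary: q rule: less_induct)
  case less
  have tree: "rooted_tree T r" using assms(1) by (simp add: normal_tree_def)
  obtain x q' where q: "q = x # q'" using less.prems(1) by (cases q) (auto simp: vpath_iff)
  show ?case
  proof (cases "q' = []")
    case True
    then show ?thesis using less.prems q by simp
  next
    case False
    then have "last q' \<in> set q'" "last q' \<in> pverts T" using less.prems(3) q by auto
    \<comment> \<open>\<open>b\<close> is the first return to \<open>T\<close>; when
      \<open>i\<close> is empty the \<open>T\<close>-path is a single edge.\<close>
    then obtain i b q'' where b: "q' = i @ b # q''" "b \<in> pverts T" "\<forall>y\<in>set i. y \<notin> pverts T"
      using split_list_first_prop[of q' "\<lambda>y. y \<in> pverts T"] by blast
    have "vpath (x # i @ [b]) (with_proj G)"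
      using less.prems(1) vpath_appendD(1)[of "x # i @ [b]" q'' G] q b by simp
    then have "path_relative_to T G (x # i @ [b])"
      using b less.prems(2) q by (auto simp: path_relative_to_def)
    then have "tree_le T r (hd (x # i @ [b])) (last (x # i @ [b])) \<or>
        tree_le T r (last (x # i @ [b])) (hd (x # i @ [b]))"
      using assms(1) unfolding normal_tree_def by blast
    then have "tree_le T r x b \<or> tree_le T r b x" by simp
    then have "tree_le T r s b"
    proof
      assume "tree_le T r x b"
      then show ?thesis using less.prems(4) q tree_le_trans[OF tree] by auto
    next
      \<comment> \<open>On a downward step, \<open>b\<close> and \<open>s\<close> both lie below
        \<open>x\<close>, hence are comparable. If \<open>b\<close> is below \<open>s\<close>, it
        equals \<open>s\<close>, since the path avoids everything at or below
        \<open>t\<close>.\<close>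
      assume bx: "tree_le T r b x"
      then consider "tree_le T r s b" | "tree_le T r b s"
        using less.prems(4) q tree_le_linear[OF tree] by auto
      then show ?thesis
      proof cases
        case 2
        then have "b = s"
          using child_le_cases[OF tree assms(2)] less.prems(5) q b by auto
        then show ?thesis using tree_le_refl[OF tree b(2)] by simp
      qed
    qed
    moreover have "vpath (b # q'') (with_proj G)"
      using less.prems(1) vpath_appendD(2)[of "x # i" "b # q''" G] q b by simp
    ultimately have "tree_le T r s (last (b # q''))"
      using less.prems q b by (intro less.hyps) auto
    then show ?thesis using q b by simp
  qed
qed

text \<open>By disjointness, each element of \<open>Y\<close> lies on at most one member of
  \<open>P\<close>.\<close>

lemma finite_disjoint_lists_meeting:
  assumes "pairwise (\<lambda>p q. set p \<inter> set q = {}) P" "finite Y"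
  shows "finite {p \<in> P. set p \<inter> Y \<noteq> {}}"
proof -
  have "finite {p \<in> P. y \<in> set p}" for y
  proof (cases "\<exists>p\<in>P. y \<in> set p")
    case True
    then obtain p where p: "p \<in> P" "y \<in> set p" by blast
    have "{p \<in> P. y \<in> set p} \<subseteq> {p}"
      using assms(1) p by (auto simp: pairwise_def)
    then show ?thesis using finite_subset by blast
  next
    case False
    then have "{p \<in> P. y \<in> set p} = {}" by blast
    then show ?thesis by (simp only: finite.emptyI)
  qed
  moreover have "{p \<in> P. set p \<inter> Y \<noteq> {}} = (\<Union>y\<in>Y. {p \<in> P. y \<in> set p})" by blast
  ultimately show ?thesis using assms(2) by simp
qed

text \<open>A finite set misses a tail of the spine and almost all paths of the comb. The paths that
  remain and start on this tail have all their teeth joined through it.\<close>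

lemma comb_almost_connected:
  assumes "pair_bidirected_digraph G" "comb G R P" "finite X"
  obtains F where "finite F" "\<And>p. p \<in> P - F \<Longrightarrow> set p \<inter> X = {}"
    "\<And>p q. p \<in> P - F \<Longrightarrow> q \<in> P - F \<Longrightarrow> (last p, last q) \<in> (arcs_off G X)\<^sup>*"
proof -
  have R: "inj R" "\<And>i. (R i, R (Suc i)) \<in> parcs G"
    and P: "\<And>p. p \<in> P \<Longrightarrow> vpath p (with_proj G)" "\<And>p. p \<in> P \<Longrightarrow> set p \<inter> range R = {hd p}"
      "pairwise (\<lambda>p q. set p \<inter> set q = {}) P"
    using assms(2) by (auto simp: comb_def ray_def)
  have "finite (R -` X)" using assms(3) R(1) by (rule finite_vimageI)
  then obtain N where N: "\<And>n. n \<in> R -` X \<Longrightarrow> n < N"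
    by (metis finite_nat_set_iff_bounded)
  have tail: "(R N, R (N + k)) \<in> (arcs_off G X)\<^sup>*" for k
  proof (induction k)
    case (Suc k)
    have "(R (N + k), R (N + Suc k)) \<in> arcs_off G X"
      using R(2)[of "N + k"] N[of "N + k"] N[of "N + Suc k"] by (auto simp: arcs_off_def)
    then show ?case using Suc by (rule rtrancl_into_rtrancl[rotated])
  qed simp
  \<comment> \<open>Besides the paths meeting \<open>X\<close>, those attached to the spine before
    the safe tail are discarded.\<close>
  define F where "F = {p \<in> P. set p \<inter> (X \<union> R ` {..<N}) \<noteq> {}}"
  have reach: "(R N, last p) \<in> (arcs_off G X)\<^sup>*" if p: "p \<in> P - F" for p
  proof -
    obtain n where n: "hd p = R n" using P(2)[of p] p by blast
    moreover have "hd p \<in> set p" using P(1)[of p] p by (simp add: vpath_iff)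
    ultimately have "\<not> n < N" using p by (auto simp: F_def)
    then have "(R N, hd p) \<in> (arcs_off G X)\<^sup>*" using tail[of "n - N"] n by simp
    moreover have "(hd p, last p) \<in> (arcs_off G X)\<^sup>*"
      using p P(1)[of p] by (intro vpath_imp_arcs_off) (auto simp: F_def)
    ultimately show ?thesis by (rule rtrancl_trans)
  qed
  show ?thesis
  proof (rule that)
    show "finite F" unfolding F_def
      using P(3) assms(3) by (intro finite_disjoint_lists_meeting) auto
    show "set p \<inter> X = {}" if "p \<in> P - F" for p using that by (auto simp: F_def)
    show "(last p, last q) \<in> (arcs_off G X)\<^sup>*" if "p \<in> P - F" "q \<in> P - F" for p q
      using arcs_off_sym[OF assms(1) reach[OF that(1)]] reach[OF that(2)] by (rule rtrancl_trans)
  qed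
qed

lemma rayless_normal_tree_no_comb:
  assumes G: "pair_bidirected_digraph G" and normal: "normal_tree G T r" and rayless: "rayless T"
    and sub: "teeth P \<subseteq> pverts T"
  shows "\<not> comb G R P"
proof
  assume comb: "comb G R P"
  then have inf: "infinite P" and vp: "\<And>p. p \<in> P \<Longrightarrow> vpath p (with_proj G)"
    by (auto simp: comb_def)
  have tree: "rooted_tree T r" and TG: "pverts T \<subseteq> pverts G"
    using normal by (auto simp: normal_tree_def subgraph_def)
  have tooth: "last p \<in> pverts T" if "p \<in> P" for p using that sub by (auto simp: teeth_def)
  \<comment> \<open>The vertices below almost all teeth. The root is one of them; it will be shown
    that each has a child of the same kind, against \<open>rayless_ex_no_child\<close>.\<close>
  define S where "S = {t \<in> pverts T. finite {p \<in> P. \<not> tree_le T r t (last p)}}"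
  have "{p \<in> P. \<not> tree_le T r r (last p)} = {}" using root_le[OF tree] tooth by blast
  then have "finite {p \<in> P. \<not> tree_le T r r (last p)}" by (simp only: finite.emptyI)
  then have "r \<in> S" using rooted_tree_root[OF tree] unfolding S_def by blast
  then have "S \<noteq> {}" by blast
  from rayless_ex_no_child[OF tree rayless this]
  obtain m where m: "m \<in> S" and no: "\<forall>c. child T r m c \<longrightarrow> c \<notin> S" by blast
  have mT: "m \<in> pverts T" using m by (simp add: S_def)
  define X where "X = set (root_path T r m)"
  have mX: "m \<in> X" using tree_le_refl[OF tree mT] tree_le_iff[OF tree] by (simp add: X_def)
  have "finite X" by (simp add: X_def)
  then obtain F where F: "finite F" "\<And>p. p \<in> P - F \<Longrightarrow> set p \<inter> X = {}"
    "\<And>p q. p \<in> P - F \<Longrightarrow> q \<in> P - F \<Longrightarrow> (last p, last q) \<in> (arcs_off G X)\<^sup>*"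
    using comb_almost_connected[OF G comb] by metis
  have off: "last p \<notin> X" if "p \<in> P - F" for p
  proof -
    have "last p \<in> set p" using vp[of p] that by (simp add: vpath_iff)
    then show ?thesis using F(2)[OF that] by blast
  qed
  \<comment> \<open>Only finitely many paths are removed, so some tooth remains above
    \<open>m\<close>. It differs from \<open>m\<close>, which lies in \<open>X\<close>, and
    therefore determines a child \<open>c\<close> below it.\<close>
  have "infinite (P - F - {p \<in> P. \<not> tree_le T r m (last p)})"
    using inf F(1) m by (simp add: S_def)
  then have "P - F - {p \<in> P. \<not> tree_le T r m (last p)} \<noteq> {}" using finite.emptyI by metis
  then obtain p where p: "p \<in> P - F" "tree_le T r m (last p)" by blast
  then obtain c where c: "child T r m c" "tree_le T r c (last p)"
    using child_below[OF tree p(2)] off mX by metis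
  \<comment> \<open>Any other remaining tooth is joined to this one by a path avoiding the root path
    of \<open>m\<close>, and by normality such a path cannot leave the part above
    \<open>c\<close>.\<close>
  have "tree_le T r c (last q)" if q: "q \<in> P - F" for q
  proof -
    have "last p \<in> pverts G" using tooth TG p by blast
    from arcs_off_imp_vpath[OF G F(3)[OF p(1) q] this off[OF p(1)]]
    obtain w where w: "vpath w (with_proj G)" "hd w = last p" "last w = last q" "set w \<inter> X = {}"
      by metis
    then have "tree_le T r c (last w)"
      using normal_tree_child_closed[OF normal c(1) w(1)] tooth p q c(2) by (auto simp: X_def)
    then show ?thesis using w by simp
  qed
  then have "{q \<in> P. \<not> tree_le T r c (last q)} \<subseteq> F" by blast
  then have "c \<in> S" using F(1) child_less(4)[OF tree c(1)] finite_subset unfolding S_def by blast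
  then show False using no c(1) by blast
qed

section \<open>Rays in trees containing a set cofinally\<close>

text \<open>Each edge of the ray goes up or down one level. After an upward step the ray cannot go
  down, because it would return to the unique parent; and it cannot descend forever, because levels
  are finite.\<close>

lemma ray_eventually_child:
  assumes tree: "rooted_tree T r" and ray: "ray T R"
  obtains N where "\<And>n. n \<ge> N \<Longrightarrow> child T r (R n) (R (Suc n))"
proof -
  have R: "inj R" "\<And>i. R i \<in> pverts T" "\<And>i. (R i, R (Suc i)) \<in> parcs T"
    using ray by (auto simp: ray_def)
  have step: "child T r (R (Suc n)) (R (Suc (Suc n)))" if "child T r (R n) (R (Suc n))" for n
  proof (rule ccontr)
    assume "\<not> ?thesis"
    then have "child T r (R (Suc (Suc n))) (R (Suc n))" using arc_child[OF tree R(3)] by blast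
    then have "root_path T r (R n) = root_path T r (R (Suc (Suc n)))"
      using that by (simp add: child_def)
    then have "R n = R (Suc (Suc n))" using root_path(3)[OF tree R(2)] by metis
    then show False using injD[OF R(1)] by fastforce
  qed
  have "\<exists>N. child T r (R N) (R (Suc N))"
  proof (rule ccontr)
    assume "\<not> ?thesis"
    then have down: "child T r (R (Suc n)) (R n)" for n using arc_child[OF tree R(3)] by blast
    have "length (root_path T r (R n)) + n = length (root_path T r (R 0))" for n
    proof (induction n)
      case (Suc n)
      then show ?case using down[of n] by (simp add: child_def)
    qed simp
    from this[of "Suc (length (root_path T r (R 0)))"] show False by simp
  qed
  then obtain N where N: "child T r (R N) (R (Suc N))" by blast
  have "child T r (R n) (R (Suc n))" if "n \<ge> N" for n
    using that by (induction n rule: dec_induct) (use N step in auto)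
  then show ?thesis using that by blast
qed

text \<open>Above each vertex of an ascending ray there is a vertex of \<open>W\<close>. The root
  path to it leaves the ray at a last vertex, and its remainder is a path of the comb; unboundedly
  many leaving points occur.\<close>

lemma cofinal_ray_imp_comb:
  assumes tree: "rooted_tree T r" and cof: "contains_cofinally T r W" and "ray T R0"
  obtains R P where "comb T R P" "teeth P \<subseteq> W"
proof -
  obtain N where N: "\<And>n. n \<ge> N \<Longrightarrow> child T r (R0 n) (R0 (Suc n))"
    using ray_eventually_child[OF tree assms(3)] by blast
  define R where "R n = R0 (N + n)" for n
  have child: "child T r (R n) (R (Suc n))" for n using N[of "N + n"] by (simp add: R_def)
  have ray: "ray T R" by (intro children_ray[OF tree] child)
  then have inj: "inj R" and RT: "\<And>i. R i \<in> pverts T" by (auto simp: ray_def)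
  have mono: "tree_le T r (R i) (R j)" if "i \<le> j" for i j
    using that
  proof (induction j rule: dec_induct)
    case base
    show ?case by (rule tree_le_refl[OF tree RT])
  next
    case (step n)
    then show ?case using tree_le_trans[OF tree _ child_less(1)[OF tree child]] by blast
  qed
  \<comment> \<open>The indices at which the root path to some element of \<open>W\<close> leaves
    the ray.\<close>
  define K where
    "K = {k. \<exists>w\<in>W. tree_le T r (R k) w \<and> (\<forall>j. tree_le T r (R j) w \<longrightarrow> j \<le> k)}"
  have "\<exists>k\<ge>n. k \<in> K" for n
  proof -
    obtain w where w: "w \<in> W" "tree_le T r (R n) w"
      using cof RT[of n] unfolding contains_cofinally_def by blast
    let ?J = "{j. tree_le T r (R j) w}"
    \<comment> \<open>Root paths are finite, so only finitely many vertices of the ray lie below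
      \<open>w\<close>, and the last of them gives an element of \<open>K\<close>.\<close>
    have "?J \<subseteq> R -` set (root_path T r w)" using tree_le_iff[OF tree] by auto
    then have fin: "finite ?J" using finite_vimageI[OF _ inj] finite_subset by blast
    have "n \<in> ?J" using w by simp
    then have "Max ?J \<ge> n" "Max ?J \<in> ?J" using fin Max_in[OF fin] by (auto intro: Max_ge)
    moreover have "\<forall>j. tree_le T r (R j) w \<longrightarrow> j \<le> Max ?J" using fin by (auto intro: Max_ge)
    ultimately show ?thesis using w(1) unfolding K_def by blast
  qed
  then have "infinite K" by (metis infinite_nat_iff_unbounded_le)
  have "\<exists>p. vpath p (with_proj T) \<and> hd p = R k \<and> last p \<in> W \<and>
      (\<forall>x\<in>set p. tree_le T r (R k) x \<and> (\<forall>j. tree_le T r (R j) x \<longrightarrow> j \<le> k))" if k: "k \<in> K" for k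
  proof -
    obtain w where w: "w \<in> W" "tree_le T r (R k) w" "\<forall>j. tree_le T r (R j) w \<longrightarrow> j \<le> k"
      using k unfolding K_def by blast
    have wT: "w \<in> pverts T" "R k \<in> set (root_path T r w)" using w(2) tree_le_iff[OF tree] by auto
    \<comment> \<open>The path for \<open>k\<close> is the final segment \<open>R k # b\<close>;
      \<open>b\<close> is empty when \<open>w\<close> itself lies on the ray.\<close>
    then obtain a b where ab: "root_path T r w = a @ R k # b" by (meson split_list)
    have "vpath (R k # b) (with_proj T)"
      using root_path(1)[OF tree wT(1)] ab vpath_appendD(2)[of a "R k # b"] by simp
    moreover have "last (R k # b) = w" using root_path(3)[OF tree wT(1)] ab by simp
    moreover have "tree_le T r (R k) x \<and> (\<forall>j. tree_le T r (R j) x \<longrightarrow> j \<le> k)"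
      if x: "x \<in> set (R k # b)" for x
    proof -
      obtain c d where cd: "R k # b = c @ x # d" using x by (meson split_list)
      have "root_path T r x = (a @ c) @ [x]"
        using root_path_split[OF tree wT(1), of "a @ c" x d] ab cd by simp
      moreover have "R k \<in> set (c @ [x])" using cd by (cases c) auto
      moreover have "tree_le T r x w" using x ab wT(1) tree_le_iff[OF tree] by auto
      ultimately have "tree_le T r (R k) x" "tree_le T r x w"
        using tree_le_verts[OF tree, of x w] by (auto simp: tree_le_iff[OF tree])
      then show ?thesis using w(3) tree_le_trans[OF tree] by blast
    qed
    ultimately show ?thesis using w(1) by (intro exI[of _ "R k # b"]) simp
  qed
  then have "\<exists>Q. \<forall>k\<in>K. vpath (Q k) (with_proj T) \<and> hd (Q k) = R k \<and> last (Q k) \<in> W \<and>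
      (\<forall>x\<in>set (Q k). tree_le T r (R k) x \<and> (\<forall>j. tree_le T r (R j) x \<longrightarrow> j \<le> k))"
    by (intro bchoice) blast
  then obtain Q where Q: "\<And>k. k \<in> K \<Longrightarrow> vpath (Q k) (with_proj T)" "\<And>k. k \<in> K \<Longrightarrow> hd (Q k) = R k"
    "\<And>k. k \<in> K \<Longrightarrow> last (Q k) \<in> W"
    "\<And>k x. k \<in> K \<Longrightarrow> x \<in> set (Q k) \<Longrightarrow> tree_le T r (R k) x"
    "\<And>k x j. k \<in> K \<Longrightarrow> x \<in> set (Q k) \<Longrightarrow> tree_le T r (R j) x \<Longrightarrow> j \<le> k"
    by blast
  have "inj_on Q K" by (rule inj_onI) (metis Q(2) injD[OF inj])
  then have "infinite (Q ` K)" using \<open>infinite K\<close> finite_image_iff by blast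
  moreover have "set (Q k) \<inter> range R = {hd (Q k)}" if k: "k \<in> K" for k
  proof -
    have "hd (Q k) \<in> set (Q k)" using Q(1)[OF k] by (simp add: vpath_iff)
    moreover have "j = k" if j: "R j \<in> set (Q k)" for j
    proof -
      have "j \<le> k" using Q(5)[OF k j] mono by blast
      then have "R j = R k" using Q(4)[OF k j] mono tree_le_antisym[OF tree] by blast
      then show ?thesis using inj by (simp add: inj_eq)
    qed
    ultimately show ?thesis using Q(2)[OF k] by auto
  qed
  \<comment> \<open>A common vertex would be above both \<open>R k\<close> and \<open>R l\<close>,
    and above no later vertex than either, forcing \<open>k = l\<close>.\<close>
  moreover have "set (Q k) \<inter> set (Q l) = {}" if "k \<in> K" "l \<in> K" "k \<noteq> l" for k l
    using that Q(4,5) by (meson antisym disjoint_iff)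
  then have "pairwise (\<lambda>p q. set p \<inter> set q = {}) (Q ` K)"
    unfolding pairwise_def by blast
  ultimately have "comb T R (Q ` K)"
    using ray Q(1) unfolding comb_def by blast
  moreover have "teeth (Q ` K) \<subseteq> W" using Q(3) by (auto simp: teeth_def)
  ultimately show ?thesis using that by blast
qed

lemma comb_mono:
  assumes "comb H R P" "pverts H \<subseteq> pverts G" "parcs H \<subseteq> parcs G"
  shows "comb G R P"
  using assms(1) subsetD[OF assms(2)] subsetD[OF assms(3)] vpath_mono[OF _ assms(2,3)]
  unfolding comb_def ray_def by blast

section \<open>Extending normal trees\<close>

definition add_leaf :: "'a pair_pre_digraph \<Rightarrow> 'a \<Rightarrow> 'a \<Rightarrow> 'a pair_pre_digraph" where
  "add_leaf T t c =
     \<lparr>pverts = insert c (pverts T), parcs = insert (t, c) (insert (c, t) (parcs T))\<rparr>"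

lemma add_leaf_simps [simp]:
  "pverts (add_leaf T t c) = insert c (pverts T)"
  "parcs (add_leaf T t c) = insert (t, c) (insert (c, t) (parcs T))"
  by (simp_all add: add_leaf_def)

lemma rooted_tree_add_leaf:
  assumes tree: "rooted_tree T r" and t: "t \<in> pverts T" and c: "c \<notin> pverts T"
  shows "rooted_tree (add_leaf T t c) r"
proof -
  let ?T = "add_leaf T t c"
  note bd = rooted_tree_bidirected[OF tree]
  have bd': "pair_bidirected_digraph ?T"
    unfolding bidirected_iff using t c bidirectedD[OF bd] by auto
  have conn: "(u, v) \<in> (parcs T)\<^sup>*" if "u \<in> pverts T" "v \<in> pverts T" for u v
    using tree that connected_iff[OF bd] by (simp add: rooted_tree_def)
  have "(parcs T)\<^sup>* \<subseteq> (parcs ?T)\<^sup>*" by (intro rtrancl_mono) auto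
  then have "(u, t) \<in> (parcs ?T)\<^sup>*" "(t, u) \<in> (parcs ?T)\<^sup>*" if "u \<in> pverts ?T" for u
    using that conn t by auto
  then have "connected (with_proj ?T)"
    unfolding connected_iff[OF bd'] by (auto intro: rtrancl_trans)
  moreover have "acyclic_graph ?T"
  proof (unfold acyclic_graph_def, rule notI)
    assume "\<exists>p. vpath p (with_proj ?T) \<and> 3 \<le> length p \<and> (last p, hd p) \<in> parcs ?T"
    then obtain p where vp: "vpath p (with_proj ?T)" and len: "3 \<le> length p"
      and close: "(last p, hd p) \<in> parcs ?T" by blast
    have nb: "x = t" if "(c, x) \<in> parcs ?T \<or> (x, c) \<in> parcs ?T" for x
      using that t c bidirectedD[OF bd] by auto
    have dist: "distinct p" and succ: "successively (\<lambda>x y. (x, y) \<in> parcs ?T) p"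
      using vp by (simp_all add: vpath_iff)
    show False
    proof (cases "c \<in> set p")
      case True
      then obtain a b where ab: "p = a @ c # b" by (meson split_list)
      have prev: "last a = t" if "a \<noteq> []"
      proof -
        have "(last a, c) \<in> parcs ?T"
          using succ that unfolding ab by (simp del: add_leaf_simps add: successively_append_iff)
        then show ?thesis using nb by blast
      qed
      have succ_c: "hd b = t" if "b \<noteq> []"
      proof -
        have "(c, hd b) \<in> parcs ?T"
          using succ that unfolding ab
          by (cases b) (simp_all del: add_leaf_simps add: successively_append_iff)
        then show ?thesis using nb by blast
      qed
      \<comment> \<open>Wherever \<open>c\<close> stands in the list, both its neighbours on the
        cycle are \<open>t\<close>, which would then occur twice.\<close>
      consider "a = []" | "b = []" "a \<noteq> []" | "a \<noteq> []" "b \<noteq> []" by blast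
      then show False
      proof cases
        case 1
        then obtain y b' where b: "b = y # b'" using ab len by (cases b) auto
        have "last b = t" using nb[of "last b"] close ab 1 b by (simp del: add_leaf_simps)
        moreover have "b' \<noteq> []" using len ab 1 b by auto
        ultimately have "t \<in> set b'" using b last_in_set[of b'] by simp
        then show False using succ_c dist ab b by simp
      next
        case 2
        then obtain y a' where a: "a = y # a'" by (cases a) auto
        have "hd a = t" using nb[of "hd a"] close ab 2 by (simp del: add_leaf_simps)
        moreover have "a' \<noteq> []" using len ab 2 a by auto
        ultimately have "t = y" "t \<in> set a'" using prev[OF 2(2)] a last_in_set[of a'] by simp_all
        then show False using dist ab a by simp
      next
        case 3
        then have "t \<in> set a" "t \<in> set b"
          using prev succ_c last_in_set[of a] hd_in_set[of b] by simp_all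
        then show False using dist ab by auto
      qed
    next
      case False
      moreover have "p \<noteq> []" using len by auto
      ultimately have nc: "c \<noteq> last p" "c \<noteq> hd p" using last_in_set hd_in_set by metis+
      have "successively (\<lambda>x y. (x, y) \<in> parcs T) p"
        using succ False by (auto elim!: successively_mono)
      then have "vpath p (with_proj T)" using vp False by (auto simp: vpath_iff)
      moreover have "(last p, hd p) \<in> parcs T" using close nc by auto
      ultimately show False using tree len unfolding rooted_tree_def acyclic_graph_def by blast
    qed
  qed
  ultimately show ?thesis using bd' rooted_tree_root[OF tree] by (simp add: rooted_tree_def)
qed

lemma tree_le_add_leaf:
  assumes tree: "rooted_tree T r" and t: "t \<in> pverts T" and c: "c \<notin> pverts T"
    and x: "tree_le T r x t"
  shows "tree_le (add_leaf T t c) r x c"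
proof -
  let ?p = "root_path T r t"
  have bd: "pair_bidirected_digraph (add_leaf T t c)"
    by (rule rooted_tree_bidirected[OF rooted_tree_add_leaf[OF tree t c]])
  have "vpath ?p (with_proj (add_leaf T t c))"
    by (rule vpath_mono[OF root_path(1)[OF tree t]]) auto
  then have "vpath (?p @ [c]) (with_proj (add_leaf T t c))"
    using root_path(3)[OF tree t] root_path_subset[OF tree t] c by (intro vpath_snoc[OF bd]) auto
  moreover have "hd (?p @ [c]) = r"
    using root_path(2)[OF tree t] root_path_nonempty[OF tree t] by simp
  moreover have "x \<in> set (?p @ [c])" using x tree_le_iff[OF tree] by simp
  ultimately show ?thesis unfolding tree_le_def by (intro exI[of _ "?p @ [c]"]) simp
qed

text \<open>The assumption \<open>down\<close> says that the component of \<open>G - T\<close>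
  containing \<open>c\<close> has all its neighbours in \<open>T\<close> below \<open>t\<close>. New
  paths to check end in \<open>c\<close> and run through this component, so their other end is below
  \<open>c\<close>.\<close>

lemma normal_tree_add_leaf:
  assumes G: "pair_bidirected_digraph G" and normal: "normal_tree G T r"
    and t: "t \<in> pverts T" and c: "c \<notin> pverts T" and tc: "(t, c) \<in> parcs G"
    and down: "\<And>a x. (c, a) \<in> (arcs_off G (pverts T))\<^sup>* \<Longrightarrow> (a, x) \<in> parcs G \<Longrightarrow>
      x \<in> pverts T \<Longrightarrow> tree_le T r x t"
  shows "normal_tree G (add_leaf T t c) r"
proof -
  let ?T = "add_leaf T t c"
  have tree: "rooted_tree T r" using normal by (simp add: normal_tree_def)
  have tree': "rooted_tree ?T r" by (rule rooted_tree_add_leaf[OF tree t c])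
  have "pverts T \<subseteq> pverts G" "parcs T \<subseteq> parcs G"
    using normal subgraph_iff[OF rooted_tree_bidirected[OF tree] G] by (simp_all add: normal_tree_def)
  then have sub: "subgraph (with_proj ?T) (with_proj G)"
    unfolding subgraph_iff[OF rooted_tree_bidirected[OF tree'] G]
    using tc bidirectedD[OF G tc] by auto
  have from_c: "tree_le ?T r (last p) c"
    if p: "path_relative_to ?T G p" "hd p = c" for p
  proof -
    have vp: "vpath p (with_proj G)" and len: "length p \<ge> 2" and lt: "last p \<in> insert c (pverts T)"
      and inner: "set (butlast (tl p)) \<inter> insert c (pverts T) = {}"
      using p by (auto simp: path_relative_to_def)
    obtain y i x where "p = y # i @ [x]" by (rule list_two_ends[OF len])
    then have ix: "p = c # i @ [x]" using p(2) by simp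
    have x: "x \<in> pverts T" using lt vp ix by (auto simp: vpath_iff)
    have "vpath (c # i) (with_proj G)" using vp ix vpath_appendD(1)[of "c # i" "[x]"] by simp
    moreover have "set (c # i) \<inter> pverts T = {}" using inner ix c by auto
    ultimately have "(c, last (c # i)) \<in> (arcs_off G (pverts T))\<^sup>*"
      using vpath_imp_arcs_off[of "c # i" G "pverts T"] by simp
    moreover have "(last (c # i), x) \<in> parcs G"
      using vp ix successively_append_iff[of _ "c # i" "[x]"] by (simp add: vpath_iff)
    ultimately have "tree_le T r x t" using down x by blast
    then show ?thesis using tree_le_add_leaf[OF tree t c] ix by simp
  qed
  have "tree_le ?T r (hd p) (last p) \<or> tree_le ?T r (last p) (hd p)"
    if p: "path_relative_to ?T G p" for p
  proof -
    have vp: "vpath p (with_proj G)" and len: "length p \<ge> 2"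
      and ends: "hd p \<in> insert c (pverts T)" "last p \<in> insert c (pverts T)"
      and inner: "set (butlast (tl p)) \<inter> insert c (pverts T) = {}"
      using p by (auto simp: path_relative_to_def)
    consider "hd p = c" | "last p = c" | "hd p \<in> pverts T" "last p \<in> pverts T" using ends by blast
    then show ?thesis
    proof cases
      case 1
      then show ?thesis using from_c[OF p] by blast
    next
      case 2
      \<comment> \<open>Reversing the path reduces this case to the previous one.\<close>
      obtain y i z where "p = y # i @ [z]" by (rule list_two_ends[OF len])
      then have "set (butlast (tl (rev p))) = set (butlast (tl p))" by simp
      then have "path_relative_to ?T G (rev p)"
        using vpath_rev[OF G vp] len ends inner p
        by (simp add: path_relative_to_def hd_rev last_rev)
      moreover have "hd (rev p) = c" using 2 by (simp add: hd_rev)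
      ultimately have "tree_le ?T r (last (rev p)) c" by (rule from_c)
      then show ?thesis using 2 by (simp add: last_rev)
    next
      case 3
      then have "path_relative_to T G p"
        using vp len inner by (auto simp: path_relative_to_def)
      then have "tree_le T r (hd p) (last p) \<or> tree_le T r (last p) (hd p)"
        using normal by (simp add: normal_tree_def)
      then show ?thesis
        using tree_le_mono[of T r _ _ ?T] by (auto simp: subset_insertI2)
    qed
  qed
  then show ?thesis using tree' sub by (simp add: normal_tree_def)
qed

text \<open>The path is added one leaf at a time, so the induction generalises the tree. The last
  clause places all new vertices below the end of the path, which later preserves
  cofinality.\<close>

lemma normal_tree_add_path:
  assumes G: "pair_bidirected_digraph G" and "normal_tree G T r"
    and "t \<in> pverts T" "(t, c) \<in> parcs G"
    and "vpath (c # q) (with_proj G)" "set (c # q) \<inter> pverts T = {}"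
    and "\<And>a x. (c, a) \<in> (arcs_off G (pverts T))\<^sup>* \<Longrightarrow> (a, x) \<in> parcs G \<Longrightarrow>
      x \<in> pverts T \<Longrightarrow> tree_le T r x t"
  shows "\<exists>T'. normal_tree G T' r \<and> pverts T' = pverts T \<union> set (c # q) \<and> parcs T \<subseteq> parcs T' \<and>
    (\<forall>x\<in>insert t (set (c # q)). tree_le T' r x (last (c # q)))"
  using assms(2-)
proof (induction q arbitrary: T t c)
  case (Nil T t c)
  let ?T = "add_leaf T t c"
  have tree: "rooted_tree T r" using Nil.prems(1) by (simp add: normal_tree_def)
  have c: "c \<notin> pverts T" using Nil.prems by simp
  have n: "normal_tree G ?T r"
    by (rule normal_tree_add_leaf[OF G Nil.prems(1,2) c Nil.prems(3,6)])
  then have tree': "rooted_tree ?T r" by (simp add: normal_tree_def)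
  have "tree_le ?T r t c"
    by (intro tree_le_add_leaf[OF tree Nil.prems(2) c] tree_le_refl[OF tree Nil.prems(2)])
  moreover have "tree_le ?T r c c" by (rule tree_le_refl[OF tree']) simp
  ultimately show ?case using n by (intro exI[of _ ?T]) auto
next
  case (Cons d q T t c)
  let ?T = "add_leaf T t c"
  have tree: "rooted_tree T r" using Cons.prems(1) by (simp add: normal_tree_def)
  have c: "c \<notin> pverts T" using Cons.prems by simp
  have n: "normal_tree G ?T r"
    by (rule normal_tree_add_leaf[OF G Cons.prems(1,2) c Cons.prems(3,6)])
  then have tree': "rooted_tree ?T r" by (simp add: normal_tree_def)
  have cd: "(c, d) \<in> parcs G" and vp: "vpath (d # q) (with_proj G)" "c \<notin> set (d # q)"
    using Cons.prems(4) by (simp_all add: vpath_iff)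
  \<comment> \<open>Once \<open>c\<close> is in the tree, the component of \<open>d\<close> lies in
    the old component of \<open>c\<close>. Its neighbours in the tree are thus \<open>c\<close>
    itself or vertices below \<open>t\<close>.\<close>
  have down: "tree_le ?T r x c"
    if "(d, a) \<in> (arcs_off G (pverts ?T))\<^sup>*" "(a, x) \<in> parcs G" "x \<in> pverts ?T" for a x
  proof (cases "x = c")
    case True
    then show ?thesis using tree_le_refl[OF tree'] by simp
  next
    case False
    have "(arcs_off G (pverts ?T))\<^sup>* \<subseteq> (arcs_off G (pverts T))\<^sup>*"
      by (intro rtrancl_mono) (auto simp: arcs_off_def)
    moreover have "(c, d) \<in> arcs_off G (pverts T)"
      using cd Cons.prems(5) by (auto simp: arcs_off_def)
    ultimately have "(c, a) \<in> (arcs_off G (pverts T))\<^sup>*"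
      using that(1) by (meson converse_rtrancl_into_rtrancl subsetD)
    then have "tree_le T r x t" using Cons.prems(6) that False by simp
    then show ?thesis by (rule tree_le_add_leaf[OF tree Cons.prems(2) c])
  qed
  have "\<exists>T'. normal_tree G T' r \<and> pverts T' = pverts ?T \<union> set (d # q) \<and> parcs ?T \<subseteq> parcs T' \<and>
    (\<forall>x\<in>insert c (set (d # q)). tree_le T' r x (last (d # q)))"
    using n cd vp Cons.prems(5) down by (intro Cons.IH) auto
  then obtain T' where T': "normal_tree G T' r" "pverts T' = pverts ?T \<union> set (d # q)"
    "parcs ?T \<subseteq> parcs T'" "\<forall>x\<in>insert c (set (d # q)). tree_le T' r x (last (d # q))"
    by blast
  have "tree_le ?T r t c"
    by (intro tree_le_add_leaf[OF tree Cons.prems(2) c] tree_le_refl[OF tree Cons.prems(2)])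
  then have "tree_le T' r t c" by (rule tree_le_mono) (use T' in auto)
  then have "tree_le T' r t (last (d # q))"
    using T'(1,4) tree_le_trans[of T' r t c] by (auto simp: normal_tree_def)
  then show ?case using T' by (intro exI[of _ T']) auto
qed

section \<open>Trees as arc sets and unions of chains\<close>

text \<open>A rooted tree is determined by its root and its arcs, so Zorn's lemma can be applied to arc sets.\<close>

definition tree_of_arcs :: "'a \<Rightarrow> 'a rel \<Rightarrow> 'a pair_pre_digraph" where
  "tree_of_arcs r A = \<lparr>pverts = insert r (fst ` A), parcs = A\<rparr>"

lemma tree_of_arcs_simps [simp]:
  "pverts (tree_of_arcs r A) = insert r (fst ` A)" "parcs (tree_of_arcs r A) = A"
  by (simp_all add: tree_of_arcs_def)

text \<open>By connectedness every vertex other than the root is the head of an arc, hence by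
  symmetry also the tail of one.\<close>

lemma rooted_tree_eq_tree_of_arcs:
  assumes tree: "rooted_tree T r"
  shows "T = tree_of_arcs r (parcs T)"
proof -
  note bd = rooted_tree_bidirected[OF tree]
  have "x \<in> insert r (fst ` parcs T)" if x: "x \<in> pverts T" for x
  proof -
    have "(r, x) \<in> (parcs T)\<^sup>*"
      using tree x connected_iff[OF bd] by (simp add: rooted_tree_def)
    then show ?thesis
    proof (cases rule: rtranclE)
      case (step y)
      then have "(x, y) \<in> parcs T" using bidirectedD(3)[OF bd] by blast
      then show ?thesis by force
    qed simp
  qed
  moreover have "insert r (fst ` parcs T) \<subseteq> pverts T"
    using rooted_tree_root[OF tree] bidirectedD(1)[OF bd] by auto
  ultimately have "pverts T = insert r (fst ` parcs T)" by blast
  then show ?thesis unfolding tree_of_arcs_def by (cases T) simp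
qed

lemma trivial_tree:
  assumes G: "pair_bidirected_digraph G" and r: "r \<in> pverts G"
  shows "normal_tree G (tree_of_arcs r {}) r" "rayless (tree_of_arcs r {})"
proof -
  let ?T = "tree_of_arcs r {}"
  have bd: "pair_bidirected_digraph ?T" by (simp add: bidirected_iff)
  have "acyclic_graph ?T" by (auto simp: acyclic_graph_def)
  then have "rooted_tree ?T r" using connected_iff[OF bd] bd by (simp add: rooted_tree_def)
  moreover have "subgraph (with_proj ?T) (with_proj G)" using r subgraph_iff[OF bd G] by simp
  moreover have "\<not> path_relative_to ?T G p" for p
  proof
    assume p: "path_relative_to ?T G p"
    then have "length p \<ge> 2" by (simp add: path_relative_to_def)
    then obtain y i z where "p = y # i @ [z]" by (rule list_two_ends)
    then show False using p by (auto simp: path_relative_to_def vpath_iff)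
  qed
  ultimately show "normal_tree G ?T r" by (simp add: normal_tree_def)
  show "rayless ?T" by (simp add: rayless_def ray_def)
qed

text \<open>Each condition concerns two vertices or finitely many arcs at a time, and these already
  lie in one member of the chain.\<close>

lemma normal_tree_Union_chain:
  assumes G: "pair_bidirected_digraph G" and "C \<noteq> {}" and chain: "subset.chain \<A> C"
    and normal: "\<And>A. A \<in> C \<Longrightarrow> normal_tree G (tree_of_arcs r A) r"
  shows "normal_tree G (tree_of_arcs r (\<Union>C)) r"
proof -
  let ?T = "tree_of_arcs r (\<Union>C)"
  have tree: "rooted_tree (tree_of_arcs r A) r" if "A \<in> C" for A
    using normal[OF that] by (simp add: normal_tree_def)
  have bdA: "pair_bidirected_digraph (tree_of_arcs r A)" if "A \<in> C" for A
    using rooted_tree_bidirected[OF tree[OF that]] .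
  have sub: "insert r (fst ` A) \<subseteq> pverts G" "A \<subseteq> parcs G" if "A \<in> C" for A
    using normal[OF that] subgraph_iff[OF bdA[OF that] G] by (simp_all add: normal_tree_def)
  have mono: "pverts (tree_of_arcs r A) \<subseteq> pverts ?T" "parcs (tree_of_arcs r A) \<subseteq> parcs ?T"
    if "A \<in> C" for A using that by auto
  have bd: "pair_bidirected_digraph ?T"
    unfolding bidirected_iff
  proof (intro allI impI)
    fix u v assume "(u, v) \<in> parcs ?T"
    then obtain A where A: "A \<in> C" "(u, v) \<in> parcs (tree_of_arcs r A)" by auto
    then show "u \<in> pverts ?T \<and> v \<in> pverts ?T \<and> (v, u) \<in> parcs ?T \<and> u \<noteq> v"
      using bidirectedD[OF bdA[OF A(1)] A(2)] mono[OF A(1)] by blast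
  qed
  have single: "\<exists>A\<in>C. x \<in> pverts (tree_of_arcs r A)" if "x \<in> pverts ?T" for x
    using that assms(2) by auto
  have pair: "\<exists>A\<in>C. x \<in> pverts (tree_of_arcs r A) \<and> y \<in> pverts (tree_of_arcs r A)"
    if xy: "x \<in> pverts ?T" "y \<in> pverts ?T" for x y
  proof -
    obtain A B where AB: "A \<in> C" "B \<in> C" "x \<in> pverts (tree_of_arcs r A)" "y \<in> pverts (tree_of_arcs r B)"
      using single[OF xy(1)] single[OF xy(2)] by blast
    then have "A \<subseteq> B \<or> B \<subseteq> A" using chain unfolding subset.chain_def by blast
    then show ?thesis using AB by auto
  qed
  have "(x, y) \<in> (parcs ?T)\<^sup>*" if xy: "x \<in> pverts ?T" "y \<in> pverts ?T" for x y
  proof -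
    obtain A where A: "A \<in> C" "x \<in> pverts (tree_of_arcs r A)" "y \<in> pverts (tree_of_arcs r A)"
      using pair[OF xy] by blast
    then have "(x, y) \<in> (parcs (tree_of_arcs r A))\<^sup>*"
      using tree[OF A(1)] connected_iff[OF bdA[OF A(1)]] unfolding rooted_tree_def by blast
    then show ?thesis using rtrancl_mono[OF mono(2)[OF A(1)]] by blast
  qed
  then have conn: "connected (with_proj ?T)" using connected_iff[OF bd] by auto
  have "acyclic_graph ?T"
  proof (unfold acyclic_graph_def, rule notI)
    assume "\<exists>p. vpath p (with_proj ?T) \<and> 3 \<le> length p \<and> (last p, hd p) \<in> parcs ?T"
    then obtain p where vp: "vpath p (with_proj ?T)" and len: "3 \<le> length p"
      and close: "(last p, hd p) \<in> parcs ?T" by blast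
    \<comment> \<open>The finite arc set of the cycle, closing arc included.\<close>
    let ?E = "insert (last p, hd p) (set (vwalk_arcs p))"
    have "?E \<subseteq> \<Union>C" using vp close by (auto simp: vpath_def vwalk_def)
    then obtain A where A: "A \<in> C" "?E \<subseteq> A"
      using finite_subset_Union_chain[of ?E C \<A>] assms(2) chain by auto
    have succ: "successively (\<lambda>x y. (x, y) \<in> A) p"
      using A(2) by (simp add: vwalk_arcs_subset_iff)
    moreover have "sym A" using bidirectedD(3)[OF bdA[OF A(1)]] by (auto simp: sym_def)
    ultimately have "set p \<subseteq> fst ` A" using len by (intro successively_arcs_subset) auto
    then have "vpath p (with_proj (tree_of_arcs r A))" using vp succ by (auto simp: vpath_iff)
    moreover have "(last p, hd p) \<in> parcs (tree_of_arcs r A)" using A(2) by simp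
    ultimately show False
      using tree[OF A(1)] len unfolding rooted_tree_def acyclic_graph_def by blast
  qed
  moreover have "pverts ?T \<subseteq> pverts G"
  proof
    fix x assume "x \<in> pverts ?T"
    from single[OF this] show "x \<in> pverts G" using sub(1) by auto
  qed
  then have "subgraph (with_proj ?T) (with_proj G)"
    unfolding subgraph_iff[OF bd G] using sub(2) by auto
  moreover have "tree_le ?T r (hd p) (last p) \<or> tree_le ?T r (last p) (hd p)"
    if p: "path_relative_to ?T G p" for p
  proof -
    have "hd p \<in> pverts ?T" "last p \<in> pverts ?T" using p by (simp_all add: path_relative_to_def)
    from pair[OF this] obtain A where A: "A \<in> C" "hd p \<in> pverts (tree_of_arcs r A)"
      "last p \<in> pverts (tree_of_arcs r A)" by blast
    \<comment> \<open>Passing to a smaller tree keeps inner vertices outside it, so \<open>p\<close>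
      is also a path relative to the member containing both its ends.\<close>
    have "set (butlast (tl p)) \<inter> pverts (tree_of_arcs r A) = {}"
      using p mono(1)[OF A(1)] unfolding path_relative_to_def by blast
    then have "path_relative_to (tree_of_arcs r A) G p"
      using p A unfolding path_relative_to_def by blast
    then have "tree_le (tree_of_arcs r A) r (hd p) (last p) \<or>
        tree_le (tree_of_arcs r A) r (last p) (hd p)"
      using normal[OF A(1)] unfolding normal_tree_def by blast
    then show ?thesis using tree_le_mono[OF _ mono[OF A(1)]] by blast
  qed
  ultimately show ?thesis using bd conn by (simp add: normal_tree_def rooted_tree_def)
qed

lemma normal_tree_extend:
  assumes G: "pair_bidirected_digraph G" "connected (with_proj G)"
    and normal: "normal_tree G T r" and rayless: "rayless T"
    and u: "u \<in> pverts G" "u \<notin> pverts T"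
  shows "\<exists>T'. normal_tree G T' r \<and> u \<in> pverts T' \<and> pverts T \<subseteq> pverts T' \<and> parcs T \<subseteq> parcs T' \<and>
    (\<forall>x\<in>pverts T' - pverts T. tree_le T' r x u)"
proof -
  have tree: "rooted_tree T r" and TG: "pverts T \<subseteq> pverts G"
    using normal by (auto simp: normal_tree_def subgraph_def)
  \<comment> \<open>The vertices related to \<open>u\<close> form its component in
    \<open>G - T\<close>, and \<open>N\<close> is the set of neighbours of this component in
    \<open>T\<close>.\<close>
  define E where "E = (arcs_off G (pverts T))\<^sup>*"
  define N where "N = {x \<in> pverts T. \<exists>a. (u, a) \<in> E \<and> (a, x) \<in> parcs G}"
  have off: "a \<notin> pverts T" if "(u, a) \<in> E" for a
    using that u(2) unfolding E_def by (cases rule: rtranclE) (auto simp: arcs_off_def)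
  have inG: "a \<in> pverts G" if "(u, a) \<in> E" for a
    using that u(1) bidirectedD(2)[OF G(1)] unfolding E_def
    by (cases rule: rtranclE) (auto simp: arcs_off_def)
  have "N \<noteq> {}"
  proof -
    have "r \<in> pverts T" by (rule rooted_tree_root[OF tree])
    then obtain p where p: "vpath p (with_proj G)" "hd p = u" "last p = r"
      using connected_ex_vpath[OF G u(1), of r] TG by blast
    then have "r \<in> set p" by (auto simp: vpath_iff)
    \<comment> \<open>A path from \<open>u\<close> to the root enters \<open>T\<close> first at
      \<open>x\<close>, directly from the component of \<open>u\<close>.\<close>
    then obtain i x q where q: "p = i @ x # q" "x \<in> pverts T" "\<forall>y\<in>set i. y \<notin> pverts T"
      using split_list_first_prop[of p "\<lambda>y. y \<in> pverts T"] \<open>r \<in> pverts T\<close> by blast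
    have i: "i \<noteq> []" "hd i = u" using q p(2) u(2) by (cases i; auto)+
    then have "(u, last i) \<in> E"
      unfolding E_def using vpath_imp_arcs_off[of i G "pverts T"] vpath_appendD(1)[of i "x # q" G] p(1) q
      by auto
    moreover have "(last i, x) \<in> parcs G"
      using p(1) q(1) i by (simp add: vpath_iff successively_append_iff)
    ultimately show ?thesis using q(2) unfolding N_def by blast
  qed
  have comparable: "tree_le T r x y \<or> tree_le T r y x" if xy: "x \<in> N" "y \<in> N" for x y
  proof (cases "x = y")
    case True
    then show ?thesis using xy tree_le_refl[OF tree] by (auto simp: N_def)
  next
    case False
    obtain a b where a: "(u, a) \<in> E" "(a, x) \<in> parcs G" and b: "(u, b) \<in> E" "(b, y) \<in> parcs G"
      and xyT: "x \<in> pverts T" "y \<in> pverts T"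
      using xy by (auto simp: N_def)
    \<comment> \<open>Two neighbours of the component are joined through it by a
      \<open>T\<close>-path, so normality makes them comparable.\<close>
    have "(a, b) \<in> E"
      using arcs_off_sym[OF G(1)] a(1) b(1) unfolding E_def by (meson rtrancl_trans)
    then obtain w where w: "vpath w (with_proj G)" "hd w = a" "last w = b" "set w \<inter> pverts T = {}"
      using arcs_off_imp_vpath[OF G(1) _ inG[OF a(1)] off[OF a(1)]] unfolding E_def by metis
    have "vpath (w @ [y]) (with_proj G)"
      using w b(2) xyT by (intro vpath_snoc[OF G(1)]) auto
    moreover have "w \<noteq> []" using w(1) by (simp add: vpath_iff)
    ultimately have "vpath (x # w @ [y]) (with_proj G)"
      using w a(2) xyT False bidirectedD[OF G(1) a(2)]
      by (cases w) (auto simp: vpath_iff)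
    then have "path_relative_to T G (x # w @ [y])"
      using w(4) xyT by (simp add: path_relative_to_def)
    then have "tree_le T r (hd (x # w @ [y])) (last (x # w @ [y])) \<or>
        tree_le T r (last (x # w @ [y])) (hd (x # w @ [y]))"
      using normal unfolding normal_tree_def by blast
    then show ?thesis by simp
  qed
  have "N \<subseteq> pverts T" by (auto simp: N_def)
  \<comment> \<open>Raylessness supplies a maximal element of \<open>N\<close>; since
    \<open>N\<close> is a chain, it is the greatest.\<close>
  from rayless_ex_maximal[OF tree rayless \<open>N \<noteq> {}\<close> this]
  obtain t where t: "t \<in> N" "\<forall>x\<in>N. tree_le T r t x \<longrightarrow> x = t" by blast
  then have max: "tree_le T r x t" if "x \<in> N" for x using comparable that by metis
  obtain c where c: "(u, c) \<in> E" "(c, t) \<in> parcs G" and tT: "t \<in> pverts T"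
    using t(1) by (auto simp: N_def)
  have "(c, u) \<in> E" using arcs_off_sym[OF G(1)] c(1) unfolding E_def by blast
  then obtain p where p: "vpath p (with_proj G)" "hd p = c" "last p = u" "set p \<inter> pverts T = {}"
    using arcs_off_imp_vpath[OF G(1) _ inG[OF c(1)] off[OF c(1)]] unfolding E_def by metis
  then obtain q where q: "p = c # q" by (cases p) (auto simp: vpath_iff)
  have down: "tree_le T r x t"
    if "(c, a) \<in> (arcs_off G (pverts T))\<^sup>*" "(a, x) \<in> parcs G" "x \<in> pverts T" for a x
  proof -
    have "(u, a) \<in> E" using c(1) that(1) unfolding E_def by (rule rtrancl_trans)
    then show ?thesis using that max unfolding N_def by blast
  qed
  have "last (c # q) = u" using p(3) q by simp
  moreover have "\<exists>T'. normal_tree G T' r \<and> pverts T' = pverts T \<union> set (c # q) \<and> parcs T \<subseteq> parcs T' \<and>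
    (\<forall>x\<in>insert t (set (c # q)). tree_le T' r x (last (c # q)))"
    by (rule normal_tree_add_path[OF G(1) normal tT bidirectedD(3)[OF G(1) c(2)]])
      (use p q down in simp_all)
  ultimately obtain T' where T': "normal_tree G T' r" "pverts T' = pverts T \<union> set p"
    "parcs T \<subseteq> parcs T'" "\<forall>x\<in>insert t (set p). tree_le T' r x u"
    unfolding q by metis
  moreover have "u \<in> set p" using p(3) q by auto
  ultimately show ?thesis by (intro exI[of _ T']) auto
qed

section \<open>Existence\<close>

lemma no_comb_imp_cofinal_normal_tree:
  assumes G: "pair_bidirected_digraph G" "connected (with_proj G)" and U: "U \<subseteq> pverts G" "U \<noteq> {}"
    and no_comb: "\<And>R P. comb G R P \<Longrightarrow> \<not> teeth P \<subseteq> U"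
  shows "\<exists>T r. normal_tree G T r \<and> rayless T \<and> contains_cofinally T r U"
proof -
  obtain r where r: "r \<in> U" using U(2) by blast
  let ?T = "tree_of_arcs r"
  \<comment> \<open>Intermediate trees need not contain \<open>U\<close>, so cofinality is asked
    only for the part of \<open>U\<close> already reached. Choosing \<open>r\<close> in
    \<open>U\<close> makes the one-vertex tree qualify.\<close>
  define \<A> where "\<A> = {A. normal_tree G (?T A) r \<and> contains_cofinally (?T A) r (U \<inter> pverts (?T A))}"
  have "\<exists>M\<in>\<A>. \<forall>X\<in>\<A>. M \<subseteq> X \<longrightarrow> X = M"
  proof (rule subset_Zorn_nonempty)
    have n: "normal_tree G (?T {}) r" using trivial_tree(1)[OF G(1)] r U(1) by blast
    then have "tree_le (?T {}) r r r" by (intro tree_le_refl) (simp_all add: normal_tree_def)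
    then have "{} \<in> \<A>" using n r by (simp add: \<A>_def contains_cofinally_def)
    then show "\<A> \<noteq> {}" by blast
  next
    fix C assume C: "C \<noteq> {}" "subset.chain \<A> C"
    then have inA: "A \<in> \<A>" if "A \<in> C" for A using that unfolding subset.chain_def by blast
    have "normal_tree G (?T (\<Union>C)) r"
      using inA by (intro normal_tree_Union_chain[OF G(1) C]) (simp add: \<A>_def)
    moreover have "\<exists>w\<in>U \<inter> pverts (?T (\<Union>C)). tree_le (?T (\<Union>C)) r x w"
      if x: "x \<in> pverts (?T (\<Union>C))" for x
    proof -
      have "\<exists>A\<in>C. x \<in> pverts (?T A)" using x C(1) by auto
      then obtain A where A: "A \<in> C" "x \<in> pverts (?T A)" by blast
      have sub: "pverts (?T A) \<subseteq> pverts (?T (\<Union>C))" "parcs (?T A) \<subseteq> parcs (?T (\<Union>C))"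
        using A(1) by auto
      obtain w where "w \<in> U \<inter> pverts (?T A)" "tree_le (?T A) r x w"
        using inA[OF A(1)] A(2) unfolding \<A>_def contains_cofinally_def by blast
      then show ?thesis using tree_le_mono[OF _ sub] sub(1) by blast
    qed
    ultimately show "\<Union>C \<in> \<A>" unfolding \<A>_def contains_cofinally_def by blast
  qed
  then obtain M where M: "M \<in> \<A>" and max: "\<forall>X\<in>\<A>. M \<subseteq> X \<longrightarrow> X = M" by blast
  have normal: "normal_tree G (?T M) r" and cof: "contains_cofinally (?T M) r (U \<inter> pverts (?T M))"
    using M unfolding \<A>_def by blast+
  have tree: "rooted_tree (?T M) r" using normal by (simp add: normal_tree_def)
  have sub: "pverts (?T M) \<subseteq> pverts G" "parcs (?T M) \<subseteq> parcs G"
    using normal subgraph_iff[OF rooted_tree_bidirected[OF tree] G(1)] unfolding normal_tree_def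
    by blast+
  have rayless: "rayless (?T M)"
  proof (unfold rayless_def, rule notI)
    assume "\<exists>R. ray (?T M) R"
    then obtain R P where "comb (?T M) R P" "teeth P \<subseteq> U \<inter> pverts (?T M)"
      using cofinal_ray_imp_comb[OF tree cof] by metis
    then show False using no_comb comb_mono[OF _ sub] by blast
  qed
  have "u \<in> pverts (?T M)" if u: "u \<in> U" for u
  proof (rule ccontr)
    assume not: "u \<notin> pverts (?T M)"
    have "u \<in> pverts G" using u U(1) by blast
    from normal_tree_extend[OF G normal rayless this not]
    obtain T' where T': "normal_tree G T' r" "u \<in> pverts T'" "pverts (?T M) \<subseteq> pverts T'"
      "parcs (?T M) \<subseteq> parcs T'" "\<forall>x\<in>pverts T' - pverts (?T M). tree_le T' r x u" by blast
    \<comment> \<open>Old vertices keep their witness in \<open>U\<close>; new ones lie below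
      \<open>u\<close>.\<close>
    have "\<exists>w\<in>U \<inter> pverts T'. tree_le T' r x w" if x: "x \<in> pverts T'" for x
    proof (cases "x \<in> pverts (?T M)")
      case True
      then obtain w where "w \<in> U \<inter> pverts (?T M)" "tree_le (?T M) r x w"
        using cof unfolding contains_cofinally_def by blast
      then show ?thesis using tree_le_mono[OF _ T'(3,4)] T'(3) by blast
    next
      case False
      then show ?thesis using T'(2,5) u x by blast
    qed
    then have cof': "contains_cofinally T' r (U \<inter> pverts T')"
      by (simp add: contains_cofinally_def)
    \<comment> \<open>Maximality speaks of arc sets, so \<open>T'\<close> is recovered from its arcs
      before the two trees are compared.\<close>
    have eq: "T' = ?T (parcs T')"
      using T'(1) by (intro rooted_tree_eq_tree_of_arcs) (simp add: normal_tree_def)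
    have "parcs T' \<in> \<A>"
      using T'(1) cof' unfolding \<A>_def mem_Collect_eq eq[symmetric] by blast
    then have "parcs T' = M" using max T'(4) by simp
    then have "T' = ?T M" using eq by metis
    then show False using T'(2) not by blast
  qed
  then have "U \<inter> pverts (?T M) = U" by blast
  then show ?thesis using normal rayless cof by metis
qed

text \<open>The cofinal clause asks for non-empty \<open>U\<close>, because a tree has a root and
  some element of \<open>U\<close> must lie above it. For that clause, a tree as in (ii) excludes
  combs, and the construction without combs already yields cofinality.\<close>

theorem theorem1:
  fixes G :: "'a pair_pre_digraph" and U :: "'a set"
  assumes "pair_bidirected_digraph G" and "connected G" and "U \<subseteq> pverts G"
  shows "((\<exists>R P. comb G R P \<and> teeth P \<subseteq> U) \<or>
          (\<exists>T r. normal_tree G T r \<and> rayless T \<and> U \<subseteq> pverts T)) \<and>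
         \<not> ((\<exists>R P. comb G R P \<and> teeth P \<subseteq> U) \<and>
            (\<exists>T r. normal_tree G T r \<and> rayless T \<and> U \<subseteq> pverts T)) \<and>
         (U \<noteq> {} \<longrightarrow>
          (\<exists>T r. normal_tree G T r \<and> rayless T \<and> U \<subseteq> pverts T) \<longrightarrow>
          (\<exists>T r. normal_tree G T r \<and> rayless T \<and> contains_cofinally T r U))"
proof -
  let ?comb = "\<exists>R P. comb G R P \<and> teeth P \<subseteq> U"
  let ?tree = "\<exists>T r. normal_tree G T r \<and> rayless T \<and> U \<subseteq> pverts T"
  let ?cofinal = "\<exists>T r. normal_tree G T r \<and> rayless T \<and> contains_cofinally T r U"
  have excl: "\<not> (?comb \<and> ?tree)"
    using rayless_normal_tree_no_comb[OF assms(1)] by (meson subset_trans)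
  have cofinal: "?cofinal" if "U \<noteq> {}" "\<not> ?comb"
    using no_comb_imp_cofinal_normal_tree[OF assms that(1)] that(2) by blast
  have "?comb \<or> ?tree"
  proof (cases "U = {}")
    case True
    \<comment> \<open>For empty \<open>U\<close> any one-vertex tree serves.\<close>
    obtain r where "r \<in> pverts G" using assms(2) connected_iff[OF assms(1)] by blast
    then show ?thesis using trivial_tree[OF assms(1)] True by blast
  next
    case False
    then show ?thesis using cofinal unfolding contains_cofinally_def by blast
  qed
  then show ?thesis using excl cofinal by blast
qed

end
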